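(* Let $b\ge 2$ be an integer and let $x\ge 1$ be a real number. The type III base $b$ continued logarithm for $x$ terminates finitely if and only if $x\in\mathbb{Q}$.
   Context: Fix an integer base $b\ge 2$. For real $\alpha\ge 1$, the type III base $b$ continued logarithm for $\alpha$ is defined by the recursion $y_0=\alpha$, and for $n\ge 0$: $a_n=\lfloor \log_b y_n\rfloor$, $c_n=\lfloor y_n/b^{a_n}\rfloor$; if $y_n=c_nb^{a_n}$ the process terminates at the term $c_nb^{a_n}$; otherwise $y_{n+1}=\dfrac{b^{a_n}}{y_n-c_nb^{a_n}}$ and the process continues. (Thus $a_n\in\mathbb{Z}_{\ge 0}$ and $c_n\in\{1,\dots,b-1\}$.) *)

theory Defs
  imports Complex_Main
begin

definition clog3_exponent :: "int \<Rightarrow> real \<Rightarrow> int" where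
  "clog3_exponent b y = \<lfloor>log (of_int b) y\<rfloor>"

definition clog3_coeff :: "int \<Rightarrow> real \<Rightarrow> int" where
  "clog3_coeff b y = \<lfloor>y / of_int b powi clog3_exponent b y\<rfloor>"

definition clog3_last :: "int \<Rightarrow> real \<Rightarrow> bool" where
  "clog3_last b y \<longleftrightarrow> y = of_int (clog3_coeff b y) * of_int b powi clog3_exponent b y"

definition clog3_next :: "int \<Rightarrow> real \<Rightarrow> real" where
  "clog3_next b y =
     of_int b powi clog3_exponent b y /
       (y - of_int (clog3_coeff b y) * of_int b powi clog3_exponent b y)"

(* The n-th complete quotient y_n of alpha; None means that the process has stopped
   before index n, so that y_n does not exist. *)
primrec clog3_quotient :: "int \<Rightarrow> real \<Rightarrow> nat \<Rightarrow> real option" where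
  "clog3_quotient b \<alpha> 0 = Some \<alpha>"
| "clog3_quotient b \<alpha> (Suc n) =
     (case clog3_quotient b \<alpha> n of
        None \<Rightarrow> None
      | Some y \<Rightarrow> if clog3_last b y then None else Some (clog3_next b y))"

definition clog3_terminates :: "int \<Rightarrow> real \<Rightarrow> bool" where
  "clog3_terminates b \<alpha> \<longleftrightarrow> (\<exists>n y. clog3_quotient b \<alpha> n = Some y \<and> clog3_last b y)"

end

(* If y = p / q is a complete quotient in integers p, q > 0 and y' = p' / q' is the next one, with
   p' = b^a q and q' = p - c b^a q, then p' + q' = p - (c - 1) b^a q \<le> p, because c \<ge> 1. So the
   numerators strictly decrease and a rational expansion must stop. Conversely
   y = c b^a + b^a / y' carries rationality back from the last term. *)

theory Submission
  imports Defs
begin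

text \<open>The recursion for \<open>clog3_quotient\<close> acts at the far end of the expansion.
  Peeling off the first step instead lets inductions move the starting point from \<open>y\<close>
  to \<open>clog3_next b y\<close>.\<close>

lemma clog3_quotient_Suc_shift:
  "clog3_quotient b y (Suc n) =
     (if clog3_last b y then None else clog3_quotient b (clog3_next b y) n)"
  by (induction n) auto

lemma clog3_terminates_unfold:
  "clog3_terminates b y \<longleftrightarrow> clog3_last b y \<or> clog3_terminates b (clog3_next b y)"
proof
  assume "clog3_terminates b y"
  then obtain n z where n: "clog3_quotient b y n = Some z" "clog3_last b z"
    unfolding clog3_terminates_def by blast
  show "clog3_last b y \<or> clog3_terminates b (clog3_next b y)"
  proof (cases n)
    case 0
    then show ?thesis using n by simp
  next
    case (Suc m)
    then show ?thesis using n unfolding clog3_terminates_def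
      by (auto simp: clog3_quotient_Suc_shift simp del: clog3_quotient.simps split: if_splits)
  qed
next
  assume *: "clog3_last b y \<or> clog3_terminates b (clog3_next b y)"
  show "clog3_terminates b y"
  proof (cases "clog3_last b y")
    case True
    then show ?thesis unfolding clog3_terminates_def
      by (intro exI[of _ 0] exI[of _ y]) simp
  next
    case False
    with * obtain n z where "clog3_quotient b (clog3_next b y) n = Some z" "clog3_last b z"
      unfolding clog3_terminates_def by blast
    with False show ?thesis unfolding clog3_terminates_def
      by (metis clog3_quotient_Suc_shift)
  qed
qed

lemma Rats_powi: "x \<in> \<rat> \<Longrightarrow> x powi k \<in> \<rat>"
  for x :: "'a::field_char_0"
  by (auto simp: power_int_def)

lemma clog3_last_imp_Rats: "clog3_last b y \<Longrightarrow> y \<in> \<rat>"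
  unfolding clog3_last_def by (metis Rats_mult Rats_of_int Rats_powi)

lemma clog3_next_Rats_imp_Rats:
  assumes "b \<noteq> 0" "clog3_next b y \<in> \<rat>" "\<not> clog3_last b y"
  shows "y \<in> \<rat>"
proof -
  define B where "B = (of_int b :: real) powi clog3_exponent b y"
  define c where "c = (of_int (clog3_coeff b y) :: real)"
  have "B \<noteq> 0" using assms(1) by (simp add: B_def)
  moreover have "y \<noteq> c * B" using assms(3) by (simp add: clog3_last_def B_def c_def)
  \<comment> \<open>Since \<open>y - c * B\<close> and \<open>B\<close> are both nonzero,
    \<open>clog3_next b y\<close> is a genuine nonzero quotient and its definition can be solved for
    \<open>y\<close>.\<close>
  ultimately have "y = c * B + B / clog3_next b y"
    by (simp add: clog3_next_def flip: B_def c_def)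
  moreover have "B \<in> \<rat>" "c \<in> \<rat>" by (auto simp: B_def c_def Rats_powi)
  ultimately show ?thesis using assms(2) by (metis Rats_add Rats_divide Rats_mult)
qed

lemma clog3_terminates_imp_Rats:
  assumes "b \<noteq> 0" "clog3_terminates b y"
  shows "y \<in> \<rat>"
proof -
  \<comment> \<open>The induction on the length \<open>n\<close> keeps \<open>y\<close> arbitrary,
    because its hypothesis is applied to \<open>clog3_next b y\<close>.\<close>
  have "y \<in> \<rat>" if "clog3_quotient b y n = Some z" "clog3_last b z" for n z
    using that
  proof (induction n arbitrary: y)
    case 0
    then show ?case by (simp add: clog3_last_imp_Rats)
  next
    case (Suc n)
    then show ?case
      using clog3_next_Rats_imp_Rats[OF assms(1)]
      by (auto simp: clog3_quotient_Suc_shift simp del: clog3_quotient.simps split: if_splits)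
  qed
  with assms(2) show ?thesis unfolding clog3_terminates_def by blast
qed

text \<open>For \<open>y \<ge> 1\<close> the exponent is nonnegative, so the power is an integer.
  This is what keeps the numerators and denominators of the descent in the integers.\<close>

lemma powi_clog3_exponent:
  assumes "b \<ge> 2" "y \<ge> 1"
  obtains B :: int where "of_int B = (of_int b :: real) powi clog3_exponent b y" "B \<ge> 1" "of_int B \<le> y"
proof
  have b: "(1::real) < of_int b" using assms by simp
  have a: "clog3_exponent b y \<ge> 0"
    unfolding clog3_exponent_def using b assms(2) by (simp add: zero_le_log_cancel_iff)
  let ?B = "b ^ nat (clog3_exponent b y)"
  show *: "of_int ?B = (of_int b :: real) powi clog3_exponent b y"
    using a by (simp add: power_int_def)
  show "?B \<ge> 1" using assms(1) by (simp add: one_le_power)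
  \<comment> \<open>As a real power it can be compared with \<open>y\<close> by monotonicity, since
    a floor lies below its argument.\<close>
  have "(of_int b :: real) powi clog3_exponent b y = of_int b powr of_int (clog3_exponent b y)"
    using b by (simp add: powr_real_of_int')
  also have "\<dots> \<le> of_int b powr log (of_int b) y"
    using b by (intro powr_mono) (auto simp: clog3_exponent_def)
  also have "\<dots> = y" using b assms(2) by simp
  finally show "of_int ?B \<le> y" using * by simp
qed

text \<open>The fraction \<open>p / q\<close> is not assumed reduced: the fraction produced for the
  next quotient may have common factors, so the descent on \<open>nat p\<close> covers every
  representation with positive denominator.\<close>

lemma Rats_imp_clog3_terminates:
  assumes "b \<ge> 2"
  shows "y \<ge> 1 \<Longrightarrow> y = of_int p / of_int q \<Longrightarrow> q > 0 \<Longrightarrow> clog3_terminates b y"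
proof (induction "nat p" arbitrary: p q y rule: less_induct)
  case less
  show ?case
  proof (cases "clog3_last b y")
    case True
    then show ?thesis by (simp add: clog3_terminates_unfold[of b y])
  next
    case False
    obtain B :: int where B: "of_int B = (of_int b :: real) powi clog3_exponent b y"
        "B \<ge> 1" "of_int B \<le> y"
      using powi_clog3_exponent[OF assms less.prems(1)] .
    define c where "c = clog3_coeff b y"
    have B0: "(of_int B :: real) > 0" using B(2) by simp
    have c_floor: "c = \<lfloor>y / of_int B\<rfloor>" by (simp add: c_def clog3_coeff_def B(1))
    have c1: "c \<ge> 1" using B0 B(3) by (simp add: c_floor le_floor_iff)
    have "of_int c \<le> y / of_int B" "y / of_int B < of_int c + 1"
      unfolding c_floor by linarith+
    then have "of_int c * of_int B \<le> y" and upper: "y < (of_int c + 1) * of_int B"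
      using B0 by (simp_all add: pos_le_divide_eq pos_divide_less_eq)
    moreover have "y \<noteq> of_int c * of_int B"
      using False by (simp add: clog3_last_def c_def B(1))
    ultimately have lower: "of_int c * of_int B < y" by simp
    have nxt: "clog3_next b y = of_int B / (y - of_int c * of_int B)"
      by (simp add: clog3_next_def c_def B(1))
    \<comment> \<open>Clearing \<open>q\<close> from \<open>B / (p / q - c * B)\<close> gives
      \<open>B * q\<close> over this denominator. It is positive because the process does not stop
      at \<open>y\<close>.\<close>
    define q' where "q' = p - c * B * q"
    have q': "of_int q' = (y - of_int c * of_int B) * of_int q"
      using less.prems(2,3) by (simp add: q'_def field_simps)
    then have "(of_int q' :: real) > 0" using lower less.prems(3) by simp
    then have q'0: "q' > 0" by simp
    have "B * q \<le> c * (B * q)" using c1 B(2) less.prems(3) by simp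
    then have "B * q < p" using q'0 by (simp add: q'_def mult.assoc)
    moreover have "0 < B * q" using B(2) less.prems(3) by simp
    \<comment> \<open>Positivity of \<open>B * q\<close> forces \<open>p > 0\<close>, so truncation
      by \<open>nat\<close> does not spoil the strict inequality.\<close>
    ultimately have "nat (B * q) < nat p" by simp
    \<comment> \<open>The upper floor bound makes the remainder \<open>y - c * B\<close> smaller
      than \<open>B\<close>, so the induction hypothesis applies to the next quotient.\<close>
    moreover have "clog3_next b y \<ge> 1"
      using lower upper by (simp add: nxt pos_le_divide_eq algebra_simps)
    moreover have "clog3_next b y = of_int (B * q) / of_int q'"
      unfolding nxt q' using less.prems(3) by simp
    ultimately have "clog3_terminates b (clog3_next b y)" using less.hyps q'0 by blast
    then show ?thesis by (simp add: clog3_terminates_unfold[of b y])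
  qed
qed

theorem theorem12:
  fixes b :: int and x :: real
  assumes "b \<ge> 2" and "x \<ge> 1"
  shows "clog3_terminates b x \<longleftrightarrow> x \<in> \<rat>"
proof
  assume "clog3_terminates b x"
  then show "x \<in> \<rat>" using clog3_terminates_imp_Rats[of b x] assms(1) by simp
next
  assume "x \<in> \<rat>"
  then obtain p q where "q > 0" "x = of_int p / of_int q"
    by (elim Rats_cases') auto
  then show "clog3_terminates b x" using Rats_imp_clog3_terminates assms by blast
qed

end
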